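(* Let $k\ge 2$ be an integer. If a graph $H$ has Sidorenko's property, then the Cartesian product $H\,\square\, C_{2k}$ also has Sidorenko's property.
   Context: All graphs are finite and simple. $\mathrm{Hom}(H,G)$ is the set of graph homomorphisms from $H$ to $G$. A graph $H$ has Sidorenko's property if for every graph $G$, $|\mathrm{Hom}(H,G)|\ge |V(G)|^{|V(H)|}\left(\frac{2|E(G)|}{|V(G)|^2}\right)^{|E(H)|}$. $C_{2k}$ is the cycle of length $2k$. The Cartesian product $H_1\,\square\,H_2$ has vertex set $V(H_1)\times V(H_2)$, with $(x_1,x_2)$ and $(y_1,y_2)$ adjacent iff either $x_1y_1\in E(H_1)$ and $x_2=y_2$, or $x_2y_2\in E(H_2)$ and $x_1=y_1$. *)

theory Defs
  imports Complex_Main "HOL-Library.FuncSet" "Graph_Theory.Pair_Digraph"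
begin

text \<open>
  A finite simple graph is a \<^locale>\<open>pair_graph\<close>: finite vertex set, and a symmetric irreflexive
  set of arcs between vertices. Each undirected edge gives two arcs, so the edges proper are the
  two-element sets below.
\<close>

definition uedges :: "'a pair_pre_digraph \<Rightarrow> 'a set set" where
  "uedges G = (\<lambda>(u, v). {u, v}) ` parcs G"

text \<open>
  Homomorphisms are extensional functions on the vertex set of \<open>H\<close>, so that distinct elements of
  \<open>Hom H G\<close> differ on a vertex of \<open>H\<close>.
\<close>

definition Hom :: "'a pair_pre_digraph \<Rightarrow> 'b pair_pre_digraph \<Rightarrow> ('a \<Rightarrow> 'b) set" where
  "Hom H G = {f \<in> pverts H \<rightarrow>\<^sub>E pverts G. \<forall>(x, y) \<in> parcs H. (f x, f y) \<in> parcs G}"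

definition sidorenko_ineq :: "'a pair_pre_digraph \<Rightarrow> 'b pair_pre_digraph \<Rightarrow> bool" where
  "sidorenko_ineq H G \<longleftrightarrow>
     real (card (Hom H G)) \<ge>
       real (card (pverts G)) ^ card (pverts H) *
       (2 * real (card (uedges G)) / (real (card (pverts G)))\<^sup>2) ^ card (uedges H)"

text \<open>
  A definition cannot quantify over the vertex type of \<open>G\<close>; as every finite graph is isomorphic
  to one with vertices in \<^typ>\<open>nat\<close>, nothing is lost (lemma \<open>sidorenko_any_type\<close> below).
  If \<open>G\<close> has no vertices the inequality reads \<open>0 \<ge> 0\<close> or, for empty \<open>H\<close>, \<open>1 \<ge> 1\<close>, so there is no
  need to exclude this case.
\<close>

definition sidorenko :: "'a pair_pre_digraph \<Rightarrow> bool" where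
  "sidorenko H \<longleftrightarrow> (\<forall>G :: nat pair_pre_digraph. pair_graph G \<longrightarrow> sidorenko_ineq H G)"

definition cartesian_product ::
  "'a pair_pre_digraph \<Rightarrow> 'b pair_pre_digraph \<Rightarrow> ('a \<times> 'b) pair_pre_digraph" (infixl "\<box>" 70) where
  "H1 \<box> H2 =
     \<lparr> pverts = pverts H1 \<times> pverts H2,
       parcs = {((x1, x2), (y1, y2)) | x1 x2 y1 y2.
         (x1, x2) \<in> pverts H1 \<times> pverts H2 \<and> (y1, y2) \<in> pverts H1 \<times> pverts H2 \<and>
         ((x1, y1) \<in> parcs H1 \<and> x2 = y2 \<or> (x2, y2) \<in> parcs H2 \<and> x1 = y1)} \<rparr>"

text \<open>The cycle of length \<open>n\<close>; only meaningful for \<open>n \<ge> 3\<close>.\<close>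

definition cycle_graph :: "nat \<Rightarrow> nat pair_pre_digraph" where
  "cycle_graph n =
     \<lparr> pverts = {..<n},
       parcs = {(i, j). i < n \<and> j < n \<and> (j = (i + 1) mod n \<or> i = (j + 1) mod n)} \<rparr>"

lemma pair_graph_iff:
  "pair_graph G \<longleftrightarrow> finite (pverts G) \<and> parcs G \<subseteq> pverts G \<times> pverts G \<and> sym (parcs G) \<and> irrefl (parcs G)"
  (is "_ \<longleftrightarrow> ?R")
proof
  assume "pair_graph G"
  then interpret pair_graph G .
  show ?R
    using pair_finite_verts arc_fst_in_verts arc_snd_in_verts pair_sym_arcs pair_no_loops
    by (fastforce simp: symmetric_def irrefl_def)
next
  assume R: ?R
  then have "finite (parcs G)"
    by (meson finite_SigmaI finite_subset)
  with R show "pair_graph G"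
    by unfold_locales (auto simp: symmetric_def irrefl_def)
qed

lemma pair_graph_cartesian_product:
  assumes "pair_graph H1" "pair_graph H2"
  shows "pair_graph (H1 \<box> H2)"
  using assms unfolding pair_graph_iff cartesian_product_def
  by (auto simp: sym_def irrefl_def)

lemma pair_graph_cycle_graph:
  assumes "n \<ge> 3"
  shows "pair_graph (cycle_graph n)"
  using assms unfolding pair_graph_iff cycle_graph_def
  by (auto simp: sym_def irrefl_def mod_Suc split: if_splits)

lemma card_uedges_cycle_graph:
  assumes "n \<ge> 3"
  shows "card (uedges (cycle_graph n)) = n"
proof -
  have "uedges (cycle_graph n) = (\<lambda>i. {i, (i + 1) mod n}) ` {..<n}"
    using assms by (auto simp: uedges_def cycle_graph_def image_iff doubleton_eq_iff Bex_def)
  moreover have "inj_on (\<lambda>i. {i, (i + 1) mod n}) {..<n}"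
    using assms by (auto simp: inj_on_def doubleton_eq_iff mod_Suc split: if_splits)
  ultimately show ?thesis by (simp add: card_image)
qed

lemma sidorenko_any_type:
  fixes G :: "'b pair_pre_digraph"
  assumes H: "pair_graph H" and S: "sidorenko H" and G: "pair_graph G"
  shows "sidorenko_ineq H G"
proof -
  from G have fin: "finite (pverts G)" and sub: "parcs G \<subseteq> pverts G \<times> pverts G"
    and sy: "sym (parcs G)" and irr: "irrefl (parcs G)"
    by (auto simp: pair_graph_iff)
  from H have subH: "parcs H \<subseteq> pverts H \<times> pverts H" by (auto simp: pair_graph_iff)
  obtain f :: "'b \<Rightarrow> nat" where f: "inj_on f (pverts G)"
    using finite_imp_inj_to_nat_seg[OF fin] by metis
  define G' where "G' = \<lparr> pverts = f ` pverts G, parcs = map_prod f f ` parcs G \<rparr>"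
  have v: "pverts G' = f ` pverts G" and a: "parcs G' = map_prod f f ` parcs G"
    by (simp_all add: G'_def)
  have arc: "(f x, f y) \<in> parcs G' \<longleftrightarrow> (x, y) \<in> parcs G"
    if "x \<in> pverts G" "y \<in> pverts G" for x y
  proof
    assume "(f x, f y) \<in> parcs G'"
    then obtain u w where uw: "(u, w) \<in> parcs G" and eq: "f x = f u" "f y = f w"
      unfolding a by auto
    from uw sub have "u \<in> pverts G" "w \<in> pverts G" by auto
    with eq that have "x = u" "y = w" using f by (meson inj_onD)+
    with uw show "(x, y) \<in> parcs G" by simp
  next
    assume "(x, y) \<in> parcs G"
    then show "(f x, f y) \<in> parcs G'" unfolding a by (metis imageI map_prod_simp)
  qed
  have "pair_graph G'"
    unfolding pair_graph_iff v
  proof (intro conjI)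
    show "sym (parcs G')" 
    proof (rule symI)
      fix p q assume "(p, q) \<in> parcs G'"
      then obtain u w where "(u, w) \<in> parcs G" "p = f u" "q = f w" unfolding a by auto
      then show "(q, p) \<in> parcs G'" using sy unfolding a by (metis symD imageI map_prod_simp)
    qed
    show "irrefl (parcs G')"
      unfolding irrefl_def
    proof (intro allI notI)
      fix z assume z: "(z, z) \<in> parcs G'"
      then obtain u where u: "u \<in> pverts G" "z = f u" using sub unfolding a by auto
      with z arc have "(u, u) \<in> parcs G" by simp
      with irr show False by (simp add: irrefl_def)
    qed
    show "finite (f ` pverts G)" using fin by simp
    show "parcs G' \<subseteq> f ` pverts G \<times> f ` pverts G" using sub unfolding a by auto
  qed
  with S have ineq: "sidorenko_ineq H G'" by (auto simp: sidorenko_def)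
  have cv: "card (pverts G') = card (pverts G)" using f by (simp add: v card_image)
  have "uedges G' = (`) f ` uedges G"
    by (simp add: uedges_def a image_image case_prod_unfold)
  moreover have "inj_on ((`) f) (uedges G)"
    using sub by (intro inj_on_subset[OF inj_on_image_Pow[OF f]]) (auto simp: uedges_def)
  ultimately have ce: "card (uedges G') = card (uedges G)" by (simp add: card_image)
  have "bij_betw (\<lambda>h. restrict (f \<circ> h) (pverts H)) (Hom H G) (Hom H G')"
  proof (rule bij_betw_byWitness[where f' = "\<lambda>h. restrict (inv_into (pverts G) f \<circ> h) (pverts H)"])
    show "\<forall>h\<in>Hom H G. restrict (inv_into (pverts G) f \<circ> restrict (f \<circ> h) (pverts H)) (pverts H) = h"
      using f by (auto simp: Hom_def fun_eq_iff restrict_def PiE_iff extensional_def)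
    show "\<forall>h\<in>Hom H G'. restrict (f \<circ> restrict (inv_into (pverts G) f \<circ> h) (pverts H)) (pverts H) = h"
      by (auto simp: Hom_def v fun_eq_iff restrict_def PiE_iff extensional_def f_inv_into_f)
    show "(\<lambda>h. restrict (f \<circ> h) (pverts H)) ` Hom H G \<subseteq> Hom H G'"
    proof (intro image_subsetI)
      fix h assume "h \<in> Hom H G"
      then have h: "h \<in> pverts H \<rightarrow>\<^sub>E pverts G" and e: "\<And>x y. (x, y) \<in> parcs H \<Longrightarrow> (h x, h y) \<in> parcs G"
        by (auto simp: Hom_def)
      have "(f (h x), f (h y)) \<in> parcs G'" if "(x, y) \<in> parcs H" for x y
        using e[OF that] unfolding a by (metis imageI map_prod_simp)
      then show "restrict (f \<circ> h) (pverts H) \<in> Hom H G'"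
        using h subH by (auto simp: Hom_def v PiE_iff)
    qed
    show "(\<lambda>h. restrict (inv_into (pverts G) f \<circ> h) (pverts H)) ` Hom H G' \<subseteq> Hom H G"
    proof (intro image_subsetI)
      fix h assume "h \<in> Hom H G'"
      then have h: "h \<in> pverts H \<rightarrow>\<^sub>E f ` pverts G" and e: "\<And>x y. (x, y) \<in> parcs H \<Longrightarrow> (h x, h y) \<in> parcs G'"
        by (auto simp: Hom_def v)
      have i: "inv_into (pverts G) f (h x) \<in> pverts G" "f (inv_into (pverts G) f (h x)) = h x"
        if "x \<in> pverts H" for x
        using that h by (auto simp: PiE_iff inv_into_into f_inv_into_f)
      have "(inv_into (pverts G) f (h x), inv_into (pverts G) f (h y)) \<in> parcs G" if "(x, y) \<in> parcs H" for x y
      proof -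
        have "x \<in> pverts H" "y \<in> pverts H" using that subH by auto
        then show ?thesis using e[OF that] arc i by metis
      qed
      then show "restrict (inv_into (pverts G) f \<circ> h) (pverts H) \<in> Hom H G"
        using i subH by (auto simp: Hom_def)
    qed
  qed
  then have "card (Hom H G') = card (Hom H G)" by (simp add: bij_betw_same_card)
  with ineq cv ce show ?thesis by (simp add: sidorenko_ineq_def)
qed

end

theory Submission
  imports Defs "HOL-Analysis.Convex"
begin

text \<open>
  A homomorphism from \<open>H \<box> C\<^bsub>2k\<^esub>\<close> to \<open>G\<close> is a closed walk of length \<open>2k\<close> in the graph on \<open>Hom H G\<close>
  with vertexwise adjacency, and the number \<open>T\<close> of these controls all walks: there are at most
  \<open>\<bar>Hom H G\<bar> T\<^sup>j\<close> walks of length \<open>m = 2kj\<close>. Such a walk is also a homomorphism from \<open>H\<close> to the graph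
  \<open>Y\<close> of walks of length \<open>m\<close> in \<open>G\<close>, so Sidorenko's inequality for \<open>H\<close> and \<open>Y\<close> bounds \<open>T\<close> from below
  in terms of the number \<open>W\<close> of vertices and \<open>Q\<close> of arcs of \<open>Y\<close>; factors not growing exponentially in
  \<open>j\<close> disappear as \<open>j\<close> tends to infinity.

  It remains to see that \<open>Q / W\<^sup>2\<close> is essentially at least \<open>p\<^sup>m\<close>, where \<open>p\<close> is the edge density of \<open>G\<close>,
  although \<open>W\<close> may be much larger than \<open>N (p N)\<^sup>m\<close>, where \<open>N\<close> is the number of vertices. In spectral terms,
  let \<open>\<lambda>\<close> be the largest eigenvalue of the adjacency matrix \<open>A\<close>, and \<open>\<mu>\<close> that of the graph on the
  arcs of \<open>G\<close> in which \<open>(u, v)\<close> is adjacent to \<open>(u', v')\<close> iff \<open>uu'\<close> and \<open>vv'\<close> are arcs. Then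
  \<open>W \<approx> \<lambda>\<^sup>m\<close>, \<open>Q \<approx> \<mu>\<^sup>m\<close> and \<open>\<lambda> \<ge> p N\<close>, so that \<open>\<mu> \<ge> \<lambda>\<^sup>3 / N\<close> suffices. This holds because, for a top
  unit eigenvector \<open>x\<close> of \<open>A\<close>, the vector \<open>(x\<^sub>u x\<^sub>v)\<^sup>1\<^sup>/\<^sup>2\<close> on arcs has Rayleigh quotient
  \<open>tr B\<^sup>4 / \<lambda>\<close> with \<open>B\<^sub>u\<^sub>v = (x\<^sub>u x\<^sub>v)\<^sup>1\<^sup>/\<^sup>4 A\<^sub>u\<^sub>v\<close>, and testing \<open>B\<close> on \<open>x\<^sup>3\<^sup>/\<^sup>4\<close> gives
  \<open>tr B\<^sup>4 \<ge> \<lambda>\<^sup>4 / N\<close>. The proof avoids eigenvectors by working with Rayleigh quotients of arbitrary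
  nonnegative vectors.
\<close>

section \<open>Symmetric nonnegative matrices: norms, traces and Rayleigh quotients\<close>

text \<open>The row vector \<open>f\<close> times the \<open>m\<close>-th power of the matrix
  \<open>K\<close> on \<open>S\<close>.\<close>

primrec kiter :: "'a set \<Rightarrow> ('a \<Rightarrow> 'a \<Rightarrow> real) \<Rightarrow> ('a \<Rightarrow> real) \<Rightarrow> nat \<Rightarrow> 'a \<Rightarrow> real" where
  "kiter S K f 0 = f"
| "kiter S K f (Suc m) = (\<lambda>c. \<Sum>d\<in>S. kiter S K f m d * K d c)"

locale sym_kernel =
  fixes S :: "'a set" and K :: "'a \<Rightarrow> 'a \<Rightarrow> real"
  assumes fin: "finite S"
    and K_sym: "a \<in> S \<Longrightarrow> b \<in> S \<Longrightarrow> K a b = K b a"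
    and K_nonneg: "a \<in> S \<Longrightarrow> b \<in> S \<Longrightarrow> K a b \<ge> 0"
begin

abbreviation "it \<equiv> kiter S K"

definition ip :: "('a \<Rightarrow> real) \<Rightarrow> ('a \<Rightarrow> real) \<Rightarrow> real" where
  "ip f g = (\<Sum>a\<in>S. f a * g a)"

lemma ip_commute: "ip f g = ip g f"
  by (simp add: ip_def mult.commute)

lemma ip_nonneg: "(\<And>a. a \<in> S \<Longrightarrow> f a \<ge> 0) \<Longrightarrow> (\<And>a. a \<in> S \<Longrightarrow> g a \<ge> 0) \<Longrightarrow> ip f g \<ge> 0"
  by (auto simp: ip_def intro!: sum_nonneg)

lemma ip_self_nonneg: "ip f f \<ge> 0"
  by (auto simp: ip_def intro!: sum_nonneg)

lemma ip_mono:
  assumes "\<And>a. a \<in> S \<Longrightarrow> 0 \<le> f a \<and> f a \<le> f' a" "\<And>a. a \<in> S \<Longrightarrow> 0 \<le> g a \<and> g a \<le> g' a"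
  shows "ip f g \<le> ip f' g'"
  unfolding ip_def using assms by (intro sum_mono mult_mono) (auto intro: order_trans)

lemma ip_Cauchy_Schwarz: "(ip f g)\<^sup>2 \<le> ip f f * ip g g"
  unfolding ip_def using Cauchy_Schwarz_ineq_sum[of f g S] by (simp add: power2_eq_square)

lemma it_nonneg:
  assumes "\<And>a. a \<in> S \<Longrightarrow> f a \<ge> 0" "a \<in> S"
  shows "it f m a \<ge> 0"
  using assms(2) by (induction m arbitrary: a) (auto intro!: sum_nonneg mult_nonneg_nonneg K_nonneg assms(1))

lemma it_mono:
  assumes "\<And>a. a \<in> S \<Longrightarrow> 0 \<le> f a \<and> f a \<le> g a" "a \<in> S"
  shows "it f m a \<le> it g m a"
  using assms(2)
proof (induction m arbitrary: a)
  case (Suc m)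
  then show ?case
    using assms(1) by (auto intro!: sum_mono mult_right_mono K_nonneg)
qed (use assms in auto)

lemma it_add: "it f (i + j) = it (it f i) j"
  by (induction j) auto

text \<open>Self-adjointness: the symmetry of \<open>K\<close> moves one multiplication from one
  argument to the other.\<close>

lemma ip_it_Suc: "ip (it f (Suc i)) (it g j) = ip (it f i) (it g (Suc j))"
proof -
  have "ip (it f (Suc i)) (it g j) = (\<Sum>a\<in>S. \<Sum>d\<in>S. it f i d * K d a * it g j a)"
    by (simp add: ip_def sum_distrib_right)
  also have "\<dots> = (\<Sum>d\<in>S. \<Sum>a\<in>S. it f i d * (it g j a * K a d))"
    by (subst sum.swap) (auto intro!: sum.cong simp: K_sym)
  also have "\<dots> = ip (it f i) (it g (Suc j))"
    by (simp add: ip_def sum_distrib_left)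
  finally show ?thesis .
qed

lemma ip_it_shift: "ip (it f i) (it g j) = ip f (it g (i + j))"
proof (induction i arbitrary: j)
  case (Suc i)
  show ?case using Suc[of "Suc j"] ip_it_Suc[of f i g j] by simp
qed simp

lemma ip_it_double: "ip f (it f (2 * j)) = ip (it f j) (it f j)"
  by (simp add: ip_it_shift mult_2)

lemma it_linear:
  assumes "b \<in> S"
  shows "it f m b = (\<Sum>a\<in>S. f a * it (\<lambda>c. of_bool (c = a)) m b)"
  using assms
proof (induction m arbitrary: b)
  case 0
  then show ?case using fin by (simp add: of_bool_def if_distrib cong: if_cong)
next
  case (Suc m)
  have "it f (Suc m) b = (\<Sum>d\<in>S. \<Sum>a\<in>S. f a * it (\<lambda>c. of_bool (c = a)) m d * K d b)"
    using Suc.IH by (simp add: sum_distrib_right)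
  also have "\<dots> = (\<Sum>a\<in>S. f a * it (\<lambda>c. of_bool (c = a)) (Suc m) b)"
    by (subst sum.swap) (simp add: sum_distrib_left mult.assoc)
  finally show ?case .
qed

text \<open>The trace of the \<open>m\<close>-th power of \<open>K\<close>; the indicator functions
  are the standard basis vectors.\<close>

definition closed_weight :: "nat \<Rightarrow> real" where
  "closed_weight m = (\<Sum>a\<in>S. it (\<lambda>c. of_bool (c = a)) m a)"

text \<open>By self-adjointness each diagonal entry of \<open>K^(2k)\<close> is the squared norm of
  a row of \<open>K^k\<close>, so the trace is a squared Frobenius norm.\<close>

lemma closed_weight_double:
  "closed_weight (2 * k) = (\<Sum>a\<in>S. ip (it (\<lambda>c. of_bool (c = a)) k) (it (\<lambda>c. of_bool (c = a)) k))"
proof -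
  have "ip (\<lambda>c. of_bool (c = a)) (it (\<lambda>c. of_bool (c = a)) (2 * k)) = it (\<lambda>c. of_bool (c = a)) (2 * k) a"
    if "a \<in> S" for a
    using that fin by (simp add: ip_def of_bool_def if_distrib if_distribR cong: if_cong)
  then show ?thesis by (simp add: closed_weight_def ip_it_double)
qed

lemma closed_weight_double_nonneg: "closed_weight (2 * k) \<ge> 0"
  by (simp add: closed_weight_double sum_nonneg ip_self_nonneg)

text \<open>The Frobenius norm of the \<open>k\<close>-th power bounds its operator norm.\<close>

lemma ip_it_le_closed_weight: "ip (it f k) (it f k) \<le> ip f f * closed_weight (2 * k)"
proof -
  let ?d = "\<lambda>a c. of_bool (c = a)"
  have "ip (it f k) (it f k) = (\<Sum>b\<in>S. (\<Sum>a\<in>S. f a * it (?d a) k b)\<^sup>2)"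
    by (simp add: ip_def power2_eq_square it_linear[of _ f])
  also have "\<dots> \<le> (\<Sum>b\<in>S. ip f f * (\<Sum>a\<in>S. (it (?d a) k b)\<^sup>2))"
    by (intro sum_mono order_trans[OF Cauchy_Schwarz_ineq_sum]) (simp add: ip_def power2_eq_square)
  also have "\<dots> = ip f f * (\<Sum>b\<in>S. \<Sum>a\<in>S. (it (?d a) k b)\<^sup>2)"
    by (simp add: sum_distrib_left)
  also have "\<dots> = ip f f * closed_weight (2 * k)"
    by (subst sum.swap) (simp add: closed_weight_double ip_def power2_eq_square)
  finally show ?thesis .
qed

lemma ip_it_mult_le_closed_weight:
  "ip (it f (k * j)) (it f (k * j)) \<le> ip f f * closed_weight (2 * k) ^ j"
proof (induction j)
  case (Suc j)
  have "ip (it f (k * Suc j)) (it f (k * Suc j)) \<le> ip (it f (k * j)) (it f (k * j)) * closed_weight (2 * k)"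
    using ip_it_le_closed_weight[of "it f (k * j)" k] by (simp add: it_add[symmetric] add.commute)
  also have "\<dots> \<le> ip f f * closed_weight (2 * k) ^ j * closed_weight (2 * k)"
    using Suc by (intro mult_right_mono closed_weight_double_nonneg)
  finally show ?case by (simp add: mult_ac)
qed simp

text \<open>Cauchy-Schwarz makes the squared norms \<open>c i\<close> of the iterates log-convex, so
  their successive ratios, where defined, do not decrease. The first ratio is at least
  \<open>q\<close>, the square of the Rayleigh quotient.\<close>

lemma ip_it_even_power_mean:
  assumes "ip f f > 0"
  shows "ip f (it f (2 * j)) \<ge> ip f f * (ip f (it f 1) / ip f f) ^ (2 * j)"
proof -
  define c where "c i = ip (it f i) (it f i)" for i
  have c0: "c 0 > 0" using assms by (simp add: c_def)
  have c_nonneg: "c i \<ge> 0" for i by (simp add: c_def ip_self_nonneg)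
  define q where "q = (ip f (it f 1) / ip f f)\<^sup>2"
  have q0: "q \<ge> 0" by (simp add: q_def)
  have base: "c 1 \<ge> q * c 0"
    using ip_Cauchy_Schwarz[of f "it f 1"] assms
    by (simp add: c_def q_def power_divide field_simps power2_eq_square)
  have logconv: "(c (Suc i))\<^sup>2 \<le> c i * c (Suc (Suc i))" for i
  proof -
    have "c (Suc i) = ip (it f i) (it f (Suc (Suc i)))"
      unfolding c_def by (rule ip_it_Suc)
    then show ?thesis using ip_Cauchy_Schwarz[of "it f i" "it f (Suc (Suc i))"] by (simp only: c_def)
  qed
  have step: "c (Suc i) \<ge> q * c i" for i
  proof (induction i)
    case 0 show ?case using base by simp
  next
    case (Suc i)
    show ?case
    proof (cases "c (Suc i) = 0")
      case True then show ?thesis using c_nonneg by simp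
    next
      case False
      then have pos: "c (Suc i) > 0" using c_nonneg[of "Suc i"] by linarith
      have "q * c (Suc i) * c i \<le> c (Suc i) * c (Suc i)"
        using mult_right_mono[OF Suc, of "c (Suc i)"] pos by (simp add: mult_ac)
      also have "\<dots> \<le> c (Suc (Suc i)) * c i"
        using logconv[of i] by (simp add: power2_eq_square mult_ac)
      finally have *: "q * c (Suc i) * c i \<le> c (Suc (Suc i)) * c i" .
      \<comment> \<open>If \<open>c i\<close> vanished, log-convexity would force
        \<open>c (Suc i) = 0\<close>.\<close>
      have "c i \<noteq> 0" using logconv[of i] pos by auto
      then have "c i > 0" using c_nonneg[of i] by linarith
      with * show ?thesis by simp
    qed
  qed
  have "c j \<ge> c 0 * q ^ j"
  proof (induction j)
    case (Suc j)
    have "c 0 * q ^ Suc j = q * (c 0 * q ^ j)" by simp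
    also have "\<dots> \<le> q * c j" using Suc q0 by (intro mult_left_mono)
    also have "\<dots> \<le> c (Suc j)" by (rule step)
    finally show ?case .
  qed simp
  then show ?thesis by (simp add: c_def q_def ip_it_double power_mult)
qed

text \<open>The squared norm of \<open>it f k\<close> lies between the power mean bound and the
  Frobenius bound.\<close>

lemma closed_weight_ge_Rayleigh:
  assumes "ip f f > 0"
  shows "closed_weight (2 * k) \<ge> (ip f (it f 1) / ip f f) ^ (2 * k)"
proof -
  have "ip f f * (ip f (it f 1) / ip f f) ^ (2 * k) \<le> ip f f * closed_weight (2 * k)"
    using ip_it_even_power_mean[OF assms, of k] ip_it_le_closed_weight[of f k]
    by (simp add: ip_it_double)
  then show ?thesis using assms by (simp only: mult_le_cancel_left_pos)
qed

text \<open>A bound on Rayleigh quotients of nonnegative vectors bounds the operator norm: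
  nonnegative entries extend it to vectors of any sign, and polarization extends it to the bilinear
  form.\<close>

lemma norm_it1_le_of_Rayleigh_le:
  assumes L: "L > 0"
    and R: "\<And>x. (\<And>a. a \<in> S \<Longrightarrow> x a \<ge> 0) \<Longrightarrow> ip x (it x 1) \<le> L * ip x x"
    and g: "\<And>a. a \<in> S \<Longrightarrow> g a \<ge> 0"
  shows "ip (it g 1) (it g 1) \<le> L\<^sup>2 * ip g g"
proof -
  have mixed: "ip f (it g 1) \<le> L * (ip f f + ip g g) / 2" for f
  proof -
    have bil: "ip u (it w 1) = (\<Sum>a\<in>S. \<Sum>d\<in>S. u a * (w d * K d a))" for u w
      by (simp add: ip_def sum_distrib_left)
    have abs: "\<bar>ip u (it u 1)\<bar> \<le> L * ip u u" for u
    proof -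
      have "\<bar>ip u (it u 1)\<bar> \<le> (\<Sum>a\<in>S. \<Sum>d\<in>S. \<bar>u a * (u d * K d a)\<bar>)"
        unfolding bil by (intro order_trans[OF sum_abs] sum_mono order_trans[OF sum_abs]) simp
      also have "\<dots> = ip (\<lambda>a. \<bar>u a\<bar>) (it (\<lambda>a. \<bar>u a\<bar>) 1)"
        unfolding bil by (intro sum.cong) (auto simp: abs_mult K_nonneg)
      also have "\<dots> \<le> L * ip (\<lambda>a. \<bar>u a\<bar>) (\<lambda>a. \<bar>u a\<bar>)" by (rule R) simp
      also have "\<dots> = L * ip u u" by (simp add: ip_def abs_mult_self_eq)
      finally show ?thesis .
    qed
    let ?p = "\<lambda>a. f a + g a" and ?m = "\<lambda>a. f a - g a"
    have sym: "ip g (it f 1) = ip f (it g 1)"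
      using ip_it_Suc[of f 0 g 0] by (simp add: ip_commute)
    have "ip ?p (it ?p 1) - ip ?m (it ?m 1) = 2 * ip f (it g 1) + 2 * ip g (it f 1)"
      unfolding bil by (simp add: algebra_simps sum.distrib sum_subtractf sum_distrib_left)
    moreover have "ip ?p ?p + ip ?m ?m = 2 * (ip f f + ip g g)"
      by (simp add: ip_def algebra_simps sum.distrib sum_subtractf sum_distrib_left)
    moreover have "ip ?p (it ?p 1) - ip ?m (it ?m 1) \<le> L * (ip ?p ?p + ip ?m ?m)"
      using abs[of ?p] abs[of ?m] by (simp add: algebra_simps)
    ultimately show ?thesis using sym by (simp add: field_simps)
  qed
  \<comment> \<open>The mixed bound is applied to \<open>g\<close> and its image scaled by
    \<open>1 / L\<close>. Half of the left side then absorbs the first term on the right.\<close>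
  have "ip (\<lambda>a. h a / L) h = ip h h / L" for h
    by (simp add: ip_def sum_divide_distrib)
  moreover have "ip (\<lambda>a. h a / L) (\<lambda>a. h a / L) = ip h h / L\<^sup>2" for h
    by (simp add: ip_def sum_divide_distrib power2_eq_square)
  ultimately have "ip (it g 1) (it g 1) / L \<le> L * (ip (it g 1) (it g 1) / L\<^sup>2 + ip g g) / 2"
    using mixed[of "\<lambda>a. it g 1 a / L"] by metis
  then show ?thesis using L by (simp add: field_simps power2_eq_square)
qed

lemma norm_it_le_of_Rayleigh_le:
  assumes L: "L > 0"
    and R: "\<And>x. (\<And>a. a \<in> S \<Longrightarrow> x a \<ge> 0) \<Longrightarrow> ip x (it x 1) \<le> L * ip x x"
    and g: "\<And>a. a \<in> S \<Longrightarrow> g a \<ge> 0"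
  shows "ip (it g j) (it g j) \<le> L ^ (2 * j) * ip g g"
proof (induction j)
  case (Suc j)
  have "ip (it g (Suc j)) (it g (Suc j)) \<le> L\<^sup>2 * ip (it g j) (it g j)"
    using norm_it1_le_of_Rayleigh_le[OF L R, of "it g j"] it_nonneg[OF g] by simp
  also have "\<dots> \<le> L\<^sup>2 * (L ^ (2 * j) * ip g g)"
    using Suc by (intro mult_left_mono) auto
  finally show ?case by (simp add: power2_eq_square mult_ac)
qed simp

end

section \<open>Rayleigh quotients of a graph and of the graph on its arcs\<close>

definition adj_kernel :: "('a \<times> 'a) set \<Rightarrow> 'a \<Rightarrow> 'a \<Rightarrow> real" where
  "adj_kernel R u v = of_bool ((u, v) \<in> R)"

lemma sym_kernel_adj: "finite S \<Longrightarrow> sym R \<Longrightarrow> sym_kernel S (adj_kernel R)"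
  by unfold_locales (auto simp: adj_kernel_def sym_def)

text \<open>The tensor square of the graph. Between elements of \<open>E\<close>, a related pair is
  a homomorphic 4-cycle with the two arcs as opposite sides.\<close>

definition square_rel :: "('a \<times> 'a) set \<Rightarrow> (('a \<times> 'a) \<times> 'a \<times> 'a) set" where
  "square_rel E = {((u, v), (u', v')) | u v u' v'. (u, u') \<in> E \<and> (v, v') \<in> E}"

lemma sym_square_rel: "sym E \<Longrightarrow> sym (square_rel E)"
  by (auto simp: square_rel_def sym_def)

lemma sum_arcs_eq:
  fixes g :: "'a \<times> 'a \<Rightarrow> real"
  assumes "finite V" "E \<subseteq> V \<times> V"
  shows "sum g E = (\<Sum>u\<in>V. \<Sum>v\<in>V. adj_kernel E u v * g (u, v))"
proof -
  have "sum g E = (\<Sum>p\<in>V \<times> V. of_bool (p \<in> E) * g p)"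
    using assms by (intro sum.mono_neutral_cong_left) auto
  then show ?thesis
    by (simp add: sum.cartesian_product adj_kernel_def case_prod_unfold)
qed

locale adjacency =
  fixes V :: "'a set" and E :: "('a \<times> 'a) set"
  assumes finite_V: "finite V" and E_subset: "E \<subseteq> V \<times> V" and sym_E: "sym E"
begin

lemma finite_E: "finite E"
  using finite_V E_subset by (meson finite_SigmaI finite_subset)

sublocale A: sym_kernel V "adj_kernel E"
  by (rule sym_kernel_adj[OF finite_V sym_E])

sublocale Z: sym_kernel E "adj_kernel (square_rel E)"
  by (rule sym_kernel_adj[OF finite_E sym_square_rel[OF sym_E]])

lemma Rayleigh_eq: "A.ip x (A.it x 1) = (\<Sum>(u, v)\<in>E. x u * x v)"
proof -
  have "A.ip x (A.it x 1) = (\<Sum>u\<in>V. \<Sum>v\<in>V. adj_kernel E u v * (x u * x v))"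
    using A.K_sym by (auto simp: A.ip_def sum_distrib_left mult_ac intro!: sum.cong)
  then show ?thesis by (simp add: sum_arcs_eq[OF finite_V E_subset])
qed

text \<open>Here \<open>z\<close> stands for \<open>x^(1/4)\<close>. The right side is the trace of
  \<open>B^4\<close>, the left side the fourth power of the Rayleigh quotient of \<open>B\<close> at
  \<open>z^3\<close>.\<close>

lemma weighted_C4_ge:
  assumes z: "\<And>a. a \<in> V \<Longrightarrow> z a \<ge> 0" and pos: "(\<Sum>a\<in>V. z a ^ 6) > 0"
  shows "((\<Sum>(u, v)\<in>E. z u ^ 4 * z v ^ 4) / (\<Sum>a\<in>V. z a ^ 6)) ^ 4 \<le>
    (\<Sum>(u, v)\<in>E. \<Sum>(u', v')\<in>E. (z u)\<^sup>2 * (z v)\<^sup>2 * adj_kernel E u u' * adj_kernel E v v' * (z u')\<^sup>2 * (z v')\<^sup>2)"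
proof -
  define B where "B u v = z u * adj_kernel E u v * z v" for u v
  interpret B: sym_kernel V B
    using z A.K_sym A.K_nonneg by unfold_locales (auto simp: B_def finite_V mult_ac)
  define y where "y u = z u ^ 3" for u
  have yy: "B.ip y y = (\<Sum>a\<in>V. z a ^ 6)"
    by (simp add: B.ip_def y_def flip: power_add)
  have "B.ip y (B.it y 1) = (\<Sum>u\<in>V. \<Sum>v\<in>V. adj_kernel E u v * (z u ^ 4 * z v ^ 4))"
    using A.K_sym by (auto simp: B.ip_def B_def y_def sum_distrib_left eval_nat_numeral mult_ac intro!: sum.cong)
  then have yBy: "B.ip y (B.it y 1) = (\<Sum>(u, v)\<in>E. z u ^ 4 * z v ^ 4)"
    by (simp add: sum_arcs_eq[OF finite_V E_subset])
  have it1: "B.it (\<lambda>c. of_bool (c = a)) 1 c = B a c" if "a \<in> V" for a c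
    using that finite_V by (simp add: of_bool_def if_distrib if_distribR cong: if_cong)
  have it2: "B.it (\<lambda>c. of_bool (c = a)) 2 b = (\<Sum>c\<in>V. B a c * B c b)" if "a \<in> V" for a b
    using it1[OF that] by (simp add: numeral_2_eq_2)
  have "B.closed_weight 4 = (\<Sum>a\<in>V. \<Sum>b\<in>V. (\<Sum>c\<in>V. B a c * B c b) * (\<Sum>c\<in>V. B a c * B c b))"
    using B.closed_weight_double[of 2] it2 by (simp add: B.ip_def)
  also have "\<dots> = (\<Sum>a\<in>V. \<Sum>b\<in>V. \<Sum>c\<in>V. \<Sum>c'\<in>V. B a c * B c b * (B a c' * B c' b))"
    by (simp add: sum_product)
  \<comment> \<open>The trace runs over 4-cycles \<open>a, c, b, c'\<close>. The swaps reorder the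
    sums so that the opposite sides \<open>a c\<close> and \<open>c' b\<close> become the arcs
    \<open>(u, v)\<close> and \<open>(u', v')\<close>.\<close>
  also have "\<dots> = (\<Sum>a\<in>V. \<Sum>c\<in>V. \<Sum>b\<in>V. \<Sum>c'\<in>V. B a c * B c b * (B a c' * B c' b))"
    by (rule sum.cong[OF refl], rule sum.swap)
  also have "\<dots> = (\<Sum>a\<in>V. \<Sum>c\<in>V. \<Sum>c'\<in>V. \<Sum>b\<in>V. B a c * B c b * (B a c' * B c' b))"
    by (rule sum.cong[OF refl], rule sum.cong[OF refl], rule sum.swap)
  also have "\<dots> = (\<Sum>u\<in>V. \<Sum>v\<in>V. adj_kernel E u v * (\<Sum>u'\<in>V. \<Sum>v'\<in>V. adj_kernel E u' v' *
      ((z u)\<^sup>2 * (z v)\<^sup>2 * adj_kernel E u u' * adj_kernel E v v' * (z u')\<^sup>2 * (z v')\<^sup>2)))"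
    by (auto simp: sum_distrib_left B_def power2_eq_square mult_ac intro!: sum.cong)
  also have "\<dots> = (\<Sum>(u, v)\<in>E. \<Sum>(u', v')\<in>E. (z u)\<^sup>2 * (z v)\<^sup>2 * adj_kernel E u u' * adj_kernel E v v' * (z u')\<^sup>2 * (z v')\<^sup>2)"
    by (simp add: sum_arcs_eq[OF finite_V E_subset])
  finally have cw: "B.closed_weight 4 = \<dots>" .
  show ?thesis
    using B.closed_weight_ge_Rayleigh[of y 2] pos unfolding yy yBy by (simp add: cw)
qed

text \<open>With \<open>r\<close> the Rayleigh quotient of \<open>x\<close>, the vector
  \<open>M\<close> on arcs has squared norm \<open>r\<close> and Rayleigh quotient at least
  \<open>r^3 / N\<close>. As \<open>M\<close> is dominated by the all-ones vector, the walk count is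
  at least \<open>r * (r^3 / N)^m\<close>.\<close>

lemma Rayleigh_le_square_walks:
  assumes x: "\<And>a. a \<in> V \<Longrightarrow> x a \<ge> 0" and norm: "A.ip x x = 1" and "even m"
  shows "A.ip x (A.it x 1) ^ (3 * m + 1) \<le> Z.ip (\<lambda>_. 1) (Z.it (\<lambda>_. 1) m) * real (card V) ^ m"
proof -
  define r where "r = A.ip x (A.it x 1)"
  define N where "N = real (card V)"
  have "V \<noteq> {}" using norm by (auto simp: A.ip_def)
  then have N: "N > 0" using finite_V by (simp add: N_def card_gt_0_iff)
  have r0: "r \<ge> 0" using A.ip_nonneg A.it_nonneg x unfolding r_def by blast
  show ?thesis
  proof (cases "r = 0")
    case True
    have "Z.ip (\<lambda>_. 1) (Z.it (\<lambda>_. 1) m) \<ge> 0" by (intro Z.ip_nonneg Z.it_nonneg) auto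
    then show ?thesis unfolding r_def[symmetric] True by simp
  next
    case False
    with r0 have r: "r > 0" by simp
    define z where "z a = sqrt (sqrt (x a))" for a
    have z: "z a \<ge> 0" "x a = z a ^ 4" if "a \<in> V" for a
    proof -
      have "z a ^ 4 = ((z a)\<^sup>2)\<^sup>2" by (simp flip: power_mult)
      then show "z a \<ge> 0" "x a = z a ^ 4" using x[OF that] by (simp_all add: z_def)
    qed
    have z8: "(\<Sum>a\<in>V. z a ^ 8) = 1"
      using norm z by (simp add: A.ip_def flip: power_add)
    define s where "s = (\<Sum>a\<in>V. z a ^ 6)"
    \<comment> \<open>Two applications of Cauchy-Schwarz, splitting \<open>z^6\<close> as
      \<open>z^2 * z^4\<close> and then \<open>z^4\<close> as \<open>1 * z^4\<close>; both times the
      factor with \<open>z^8\<close> sums to 1.\<close>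
    have "s\<^sup>2 \<le> (\<Sum>a\<in>V. z a ^ 4) * 1"
      using Cauchy_Schwarz_ineq_sum[of "\<lambda>a. (z a)\<^sup>2" "\<lambda>a. z a ^ 4" V] z8
      by (simp add: s_def flip: power_add power_mult)
    moreover have "(\<Sum>a\<in>V. z a ^ 4)\<^sup>2 \<le> N"
      using Cauchy_Schwarz_ineq_sum[of "\<lambda>a. 1" "\<lambda>a. z a ^ 4" V] z8
      by (simp add: N_def flip: power_mult)
    ultimately have s4: "s ^ 4 \<le> N"
      using power_mono[of "s\<^sup>2" "\<Sum>a\<in>V. z a ^ 4" 2] by (simp flip: power_mult)
    have s_pos: "s > 0"
    proof -
      have "s \<ge> 0" unfolding s_def using z by (intro sum_nonneg) auto
      moreover have "s \<noteq> 0"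
      proof
        assume "s = 0"
        then have "\<forall>a\<in>V. z a = 0"
          unfolding s_def using z finite_V by (subst (asm) sum_nonneg_eq_0_iff) auto
        with z8 show False by simp
      qed
      ultimately show ?thesis by simp
    qed
    \<comment> \<open>The vector \<open>(x u * x v)^(1/2)\<close> on the arcs.\<close>
    define M where "M p = (z (fst p))\<^sup>2 * (z (snd p))\<^sup>2" for p
    have in_V: "u \<in> V" "v \<in> V" if "(u, v) \<in> E" for u v using that E_subset by auto
    have r_eq: "r = (\<Sum>(u, v)\<in>E. z u ^ 4 * z v ^ 4)"
      unfolding r_def Rayleigh_eq
    proof (intro sum.cong refl, clarify)
      fix u v assume "(u, v) \<in> E"
      then show "x u * x v = z u ^ 4 * z v ^ 4" using z(2) in_V by simp
    qed
    have MM: "Z.ip M M = r"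
      unfolding r_eq by (auto simp: Z.ip_def M_def power4_eq_xxxx power2_eq_square mult_ac intro!: sum.cong)
    have "Z.ip M (Z.it M 1) =
      (\<Sum>(u, v)\<in>E. \<Sum>(u', v')\<in>E. (z u)\<^sup>2 * (z v)\<^sup>2 * adj_kernel E u u' * adj_kernel E v v' * (z u')\<^sup>2 * (z v')\<^sup>2)"
      using sym_E by (auto simp: Z.ip_def M_def sum_distrib_left adj_kernel_def square_rel_def sym_def
          of_bool_def mult_ac intro!: sum.cong)
    then have "Z.ip M (Z.it M 1) \<ge> (r / s) ^ 4"
      using weighted_C4_ge[of z] z s_pos by (simp add: r_eq s_def)
    moreover have "(r / s) ^ 4 \<ge> r ^ 4 / N"
      using s4 s_pos r N by (simp add: power_divide frac_le)
    ultimately have MZM: "Z.ip M (Z.it M 1) \<ge> r ^ 4 / N" by linarith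
    have M01: "0 \<le> M p \<and> M p \<le> 1" if "p \<in> E" for p
    proof -
      have "z a \<le> 1" if "a \<in> V" for a
      proof -
        have "z a ^ 8 \<le> (\<Sum>a\<in>V. z a ^ 8)"
          using that finite_V by (intro member_le_sum) auto
        then show ?thesis using z8 z(1)[OF that] by (simp add: power_le_one_iff)
      qed
      then show ?thesis using that in_V z(1) unfolding M_def
        by (cases p) (auto intro!: mult_le_one power_le_one)
    qed
    obtain j where m: "m = 2 * j" using \<open>even m\<close> by auto
    have "r * (r ^ 3 / N) ^ m \<le> r * (Z.ip M (Z.it M 1) / r) ^ m"
      using MZM r N by (intro mult_left_mono power_mono) (auto simp: field_simps eval_nat_numeral)
    also have "\<dots> \<le> Z.ip M (Z.it M m)"
      using Z.ip_it_even_power_mean[of M j] r by (simp add: MM m)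
    also have "\<dots> \<le> Z.ip (\<lambda>_. 1) (Z.it (\<lambda>_. 1) m)"
      by (intro Z.ip_mono conjI Z.it_mono Z.it_nonneg) (auto simp: M01)
    finally have "r * (r ^ 3 / N) ^ m \<le> Z.ip (\<lambda>_. 1) (Z.it (\<lambda>_. 1) m)" .
    then have "r * (r ^ 3) ^ m \<le> Z.ip (\<lambda>_. 1) (Z.it (\<lambda>_. 1) m) * N ^ m"
      using N by (simp add: power_divide field_simps)
    then show ?thesis by (simp add: r_def N_def power_mult)
  qed
qed

text \<open>The first bound is the power mean at the all-ones vector. For the second, a number
  \<open>L\<close> determined by \<open>Q\<close> replaces the largest eigenvalue: it bounds every
  Rayleigh quotient, hence both \<open>W\<close> and the average degree \<open>d\<close>.\<close>

lemma walk_bounds: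
  fixes m :: nat
  defines "N \<equiv> real (card V)" and "d \<equiv> real (card E) / real (card V)"
  defines "W \<equiv> A.ip (\<lambda>_. 1) (A.it (\<lambda>_. 1) m)" and "Q \<equiv> Z.ip (\<lambda>_. 1) (Z.it (\<lambda>_. 1) m)"
  assumes "E \<noteq> {}" "even m"
  shows "N * d ^ m \<le> W" "W\<^sup>2 * d ^ (m + 1) \<le> Q * N ^ (m + 2)"
proof -
  have "V \<noteq> {}" using E_subset \<open>E \<noteq> {}\<close> by auto
  then have N: "N > 0" using finite_V by (simp add: N_def card_gt_0_iff)
  have d: "d > 0" using N finite_E \<open>E \<noteq> {}\<close> by (simp add: d_def N_def card_gt_0_iff)
  obtain j where m: "m = 2 * j" using \<open>even m\<close> by auto
  have ip1: "A.ip (\<lambda>_. 1) (\<lambda>_. 1) = N" by (simp add: A.ip_def N_def)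
  have ip1A: "A.ip (\<lambda>_. 1) (A.it (\<lambda>_. 1) 1) = N * d"
    unfolding Rayleigh_eq using N by (simp add: d_def N_def)
  show "N * d ^ m \<le> W"
    using A.ip_it_even_power_mean[of "\<lambda>_. 1" j] N unfolding ip1 ip1A by (simp add: W_def m)
  have Q0: "Q \<ge> 0" unfolding Q_def using Z.ip_nonneg Z.it_nonneg by simp
  \<comment> \<open>Chosen so that \<open>Rayleigh_le_square_walks\<close> says exactly that
    Rayleigh quotients are at most \<open>L\<close>.\<close>
  define L where "L = root (3 * m + 1) (Q * N ^ m)"
  have Lpow: "L ^ (3 * m + 1) = Q * N ^ m"
    unfolding L_def using Q0 N by (intro real_root_pow_pos2) auto
  have Ray: "A.ip x (A.it x 1) \<le> L * A.ip x x" if x: "\<And>a. a \<in> V \<Longrightarrow> x a \<ge> 0" for x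
  proof (cases "A.ip x x = 0")
    case True
    then have "\<forall>a\<in>V. x a = 0"
      unfolding A.ip_def using finite_V by (subst (asm) sum_nonneg_eq_0_iff) auto
    with True show ?thesis by (simp add: A.ip_def)
  next
    case False
    then have pos: "A.ip x x > 0" using A.ip_self_nonneg[of x] by linarith
    define t where "t = sqrt (A.ip x x)"
    have t: "t > 0" "t * t = A.ip x x" using pos by (auto simp: t_def)
    define y where "y a = x a / t" for a
    have "A.ip y y = 1"
      using pos by (simp add: y_def A.ip_def t(2)[unfolded A.ip_def] flip: sum_divide_distrib)
    moreover have yr: "A.ip y (A.it y 1) = A.ip x (A.it x 1) / A.ip x x"
      unfolding Rayleigh_eq y_def t(2)[symmetric] by (simp add: sum_divide_distrib case_prod_unfold)
    ultimately have "A.ip y (A.it y 1) ^ (3 * m + 1) \<le> L ^ (3 * m + 1)"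
      unfolding Lpow Q_def N_def using x t(1) \<open>even m\<close>
      by (intro Rayleigh_le_square_walks) (auto simp: y_def)
    then have "A.ip y (A.it y 1) \<le> L"
      using Q0 N by (rule_tac power_le_imp_le_base[of _ "3 * m"]) (auto simp: L_def)
    then show ?thesis unfolding yr using pos by (simp add: field_simps)
  qed
  have dL: "d \<le> L" using Ray[of "\<lambda>_. 1"] N unfolding ip1 ip1A by simp
  with d have L: "L > 0" by simp
  have W0: "W \<ge> 0" unfolding W_def using A.ip_nonneg A.it_nonneg by simp
  have "W \<le> L ^ m * N"
    using A.norm_it_le_of_Rayleigh_le[OF L Ray, of "\<lambda>_. 1" j] unfolding ip1
    by (simp add: W_def m A.ip_it_double)
  \<comment> \<open>\<open>W^2\<close> contributes \<open>L^(2m)\<close>; the factor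
    \<open>d^(m + 1)\<close> supplies what is missing up to the exponent \<open>3m + 1\<close> in
    the definition of \<open>L\<close>.\<close>
  then have "W\<^sup>2 * d ^ (m + 1) \<le> (L ^ m * N)\<^sup>2 * L ^ (m + 1)"
    using d dL W0 by (intro mult_mono power_mono) auto
  also have "\<dots> = L ^ (3 * m + 1) * N\<^sup>2"
  proof -
    have "3 * m + 1 = m + m + (m + 1)" by simp
    then show ?thesis by (simp only: power_add) (simp add: power2_eq_square mult_ac)
  qed
  also have "\<dots> = Q * N ^ (m + 2)"
    by (simp only: Lpow) (simp add: power2_eq_square mult_ac)
  finally show "W\<^sup>2 * d ^ (m + 1) \<le> Q * N ^ (m + 2)" .
qed

end

section \<open>Walk counts through matrix powers\<close>

definition walks :: "'a set \<Rightarrow> ('a \<times> 'a) set \<Rightarrow> nat \<Rightarrow> (nat \<Rightarrow> 'a) set" where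
  "walks S R m = {w \<in> {..m} \<rightarrow>\<^sub>E S. \<forall>i<m. (w i, w (Suc i)) \<in> R}"

lemma finite_walks: "finite S \<Longrightarrow> finite (walks S R m)"
  unfolding walks_def by (rule finite_subset[of _ "{..m} \<rightarrow>\<^sub>E S"]) (auto intro: finite_PiE)

lemma bij_betw_walks_Suc:
  assumes "b \<in> S"
  shows "bij_betw (\<lambda>w. w(Suc m := b)) {w \<in> walks S R m. (w m, b) \<in> R} {w \<in> walks S R (Suc m). w (Suc m) = b}"
proof (rule bij_betw_byWitness[where f' = "\<lambda>w. restrict w {..m}"])
  show "(\<lambda>w. w(Suc m := b)) ` {w \<in> walks S R m. (w m, b) \<in> R} \<subseteq> {w \<in> walks S R (Suc m). w (Suc m) = b}"
    using assms by (auto simp: walks_def PiE_iff extensional_def less_Suc_eq le_Suc_eq)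
  show "(\<lambda>w. restrict w {..m}) ` {w \<in> walks S R (Suc m). w (Suc m) = b} \<subseteq> {w \<in> walks S R m. (w m, b) \<in> R}"
    by (auto simp: walks_def PiE_iff)
qed (auto simp: walks_def PiE_iff extensional_def fun_eq_iff le_Suc_eq)

text \<open>Deleting the last vertex of a walk corresponds to one multiplication by the adjacency
  matrix. The weight \<open>f\<close> at the start is general: constant 1 counts all walks, an
  indicator counts closed ones.\<close>

lemma sum_walks_ending:
  assumes "finite S" "b \<in> S"
  shows "(\<Sum>w | w \<in> walks S R m \<and> w m = b. f (w 0)) = kiter S (adj_kernel R) f m b"
  using assms(2)
proof (induction m arbitrary: b)
  case 0
  have "{w \<in> walks S R 0. w 0 = b} = {\<lambda>i\<in>{0}. b}"
    using 0 by (auto simp: walks_def PiE_iff extensional_def fun_eq_iff)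
  then show ?case by simp
next
  case (Suc m)
  have "(\<Sum>w | w \<in> walks S R (Suc m) \<and> w (Suc m) = b. f (w 0)) =
    (\<Sum>w | w \<in> walks S R m \<and> (w m, b) \<in> R. f (w 0))"
    by (subst sum.reindex_bij_betw[OF bij_betw_walks_Suc[OF Suc.prems], symmetric]) simp
  also have "\<dots> = (\<Sum>w\<in>walks S R m. f (w 0) * adj_kernel R (w m) b)"
    using finite_walks[OF assms(1)] by (intro sum.mono_neutral_cong_left) (auto simp: adj_kernel_def)
  also have "\<dots> = (\<Sum>d\<in>S. \<Sum>w | w \<in> walks S R m \<and> w m = d. f (w 0) * adj_kernel R (w m) b)"
    using assms(1) finite_walks by (intro sum.group[symmetric]) (auto simp: walks_def)
  also have "\<dots> = (\<Sum>d\<in>S. kiter S (adj_kernel R) f m d * adj_kernel R d b)"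
    using Suc.IH by (intro sum.cong) (auto simp flip: sum_distrib_right)
  finally show ?case by simp
qed

lemma sum_walks:
  assumes "finite S"
  shows "(\<Sum>w\<in>walks S R m. g (w m) * f (w 0)) = (\<Sum>b\<in>S. g b * kiter S (adj_kernel R) f m b)"
proof -
  have "(\<Sum>w\<in>walks S R m. g (w m) * f (w 0)) = (\<Sum>b\<in>S. \<Sum>w | w \<in> walks S R m \<and> w m = b. g (w m) * f (w 0))"
    using assms finite_walks by (intro sum.group[symmetric]) (auto simp: walks_def)
  also have "\<dots> = (\<Sum>b\<in>S. g b * kiter S (adj_kernel R) f m b)"
    using assms by (intro sum.cong) (auto simp: sum_walks_ending simp flip: sum_distrib_left)
  finally show ?thesis .
qed

lemma card_walks:
  assumes "finite S" "sym R"
  shows "real (card (walks S R m)) = sym_kernel.ip S (\<lambda>_. 1) (kiter S (adj_kernel R) (\<lambda>_. 1) m)"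
  using sum_walks[where g = "\<lambda>_. 1" and f = "\<lambda>_. 1", OF assms(1)] assms
  by (simp add: sym_kernel.ip_def[OF sym_kernel_adj])

lemma card_closed_walks:
  assumes "finite S" "sym R"
  shows "real (card {w \<in> walks S R m. w m = w 0}) = sym_kernel.closed_weight S (adj_kernel R) m"
proof -
  have "real (card {w \<in> walks S R m. w m = w 0}) = (\<Sum>w\<in>walks S R m. of_bool (w m = w 0))"
    using finite_walks[OF assms(1)] by (simp add: of_bool_def flip: sum.inter_filter)
  also have "\<dots> = (\<Sum>b\<in>S. \<Sum>w | w \<in> walks S R m \<and> w m = b. of_bool (w m = w 0))"
    using assms finite_walks by (intro sum.group[symmetric]) (auto simp: walks_def)
  \<comment> \<open>Once the end \<open>b\<close> is fixed, closedness is a weight on the starting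
    vertex alone.\<close>
  also have "\<dots> = (\<Sum>b\<in>S. \<Sum>w | w \<in> walks S R m \<and> w m = b. of_bool (w 0 = b))"
    by (intro sum.cong) auto
  also have "\<dots> = (\<Sum>b\<in>S. kiter S (adj_kernel R) (\<lambda>c. of_bool (c = b)) m b)"
    using assms(1) by (intro sum.cong refl) (rule sum_walks_ending)
  finally show ?thesis using assms by (simp add: sym_kernel.closed_weight_def[OF sym_kernel_adj])
qed

section \<open>Arc and edge counts\<close>

lemma card_parcs:
  assumes "pair_graph G"
  shows "card (parcs G) = 2 * card (uedges G)"
proof -
  have fin: "finite (parcs G)" and sy: "sym (parcs G)" and irr: "irrefl (parcs G)"
    using assms by (auto simp: pair_graph_iff intro: finite_subset)
  have "card (parcs G) = (\<Sum>a\<in>parcs G. 1)" by simp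
  also have "\<dots> = (\<Sum>e\<in>uedges G. \<Sum>a | a \<in> parcs G \<and> (\<lambda>(u, v). {u, v}) a = e. 1)"
    using fin by (intro sum.group[symmetric]) (auto simp: uedges_def)
  also have "\<dots> = (\<Sum>e\<in>uedges G. 2)"
  proof (rule sum.cong[OF refl])
    fix e assume "e \<in> uedges G"
    then obtain u v where uv: "(u, v) \<in> parcs G" "e = {u, v}" by (auto simp: uedges_def)
    then have "{a \<in> parcs G. (\<lambda>(u, v). {u, v}) a = e} = {(u, v), (v, u)}"
      using sy by (auto simp: doubleton_eq_iff sym_def)
    moreover have "u \<noteq> v" using uv irr by (auto simp: irrefl_def)
    ultimately show "(\<Sum>a | a \<in> parcs G \<and> (\<lambda>(u, v). {u, v}) a = e. 1) = 2" by simp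
  qed
  finally show ?thesis by simp
qed

lemma card_uedges_cartesian_product:
  assumes "pair_graph H1" "pair_graph H2"
  shows "card (uedges (H1 \<box> H2)) =
    card (uedges H1) * card (pverts H2) + card (pverts H1) * card (uedges H2)"
proof -
  have fin: "finite (pverts H1)" "finite (pverts H2)" "finite (parcs H1)" "finite (parcs H2)"
    and sub: "parcs H1 \<subseteq> pverts H1 \<times> pverts H1" "parcs H2 \<subseteq> pverts H2 \<times> pverts H2"
    and irr: "irrefl (parcs H1)" "irrefl (parcs H2)"
    using assms by (auto simp: pair_graph_iff intro: finite_subset)
  let ?f = "\<lambda>((x, y), z). ((x, z), (y, z))" and ?g = "\<lambda>(z, (x, y)). ((z, x), (z, y))"
  have "?f ` (parcs H1 \<times> pverts H2) = {((x, z), (y, z)) | x y z. (x, y) \<in> parcs H1 \<and> z \<in> pverts H2}"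
    "?g ` (pverts H1 \<times> parcs H2) = {((z, x), (z, y)) | x y z. (x, y) \<in> parcs H2 \<and> z \<in> pverts H1}"
    by (auto simp: image_iff Bex_def)
  then have "parcs (H1 \<box> H2) = ?f ` (parcs H1 \<times> pverts H2) \<union> ?g ` (pverts H1 \<times> parcs H2)"
    using sub by (auto simp: cartesian_product_def)
  \<comment> \<open>An arc of both kinds would fix both coordinates and so project to a
    loop.\<close>
  moreover have "?f ` (parcs H1 \<times> pverts H2) \<inter> ?g ` (pverts H1 \<times> parcs H2) = {}"
    using irr by (auto simp: irrefl_def)
  moreover have "inj_on ?f (parcs H1 \<times> pverts H2)" "inj_on ?g (pverts H1 \<times> parcs H2)"
    by (auto simp: inj_on_def)
  ultimately have "card (parcs (H1 \<box> H2)) = card (parcs H1) * card (pverts H2) + card (pverts H1) * card (parcs H2)"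
    using fin by (simp add: card_Un_disjoint card_image card_cartesian_product)
  then show ?thesis
    using assms by (simp add: card_parcs pair_graph_cartesian_product)
qed

section \<open>Homomorphisms as walks\<close>

text \<open>The graph \<open>Y\<close> of the overview, an induced subgraph of the
  \<open>(m + 1)\<close>-fold tensor power of \<open>G\<close>.\<close>

definition walk_graph :: "'a pair_pre_digraph \<Rightarrow> nat \<Rightarrow> (nat \<Rightarrow> 'a) pair_pre_digraph" where
  "walk_graph G m =
     \<lparr> pverts = walks (pverts G) (parcs G) m,
       parcs = {(w, w'). w \<in> walks (pverts G) (parcs G) m \<and> w' \<in> walks (pverts G) (parcs G) m \<and>
         (\<forall>i\<le>m. (w i, w' i) \<in> parcs G)} \<rparr>"

lemma pair_graph_walk_graph:
  assumes "pair_graph G"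
  shows "pair_graph (walk_graph G m)"
  using assms unfolding pair_graph_iff walk_graph_def
  by (auto simp: finite_walks sym_def irrefl_def)

text \<open>Two walks adjacent at every time are zipped into one walk on the arcs of
  \<open>G\<close>.\<close>

lemma card_parcs_walk_graph:
  assumes "pair_graph G"
  shows "card (parcs (walk_graph G m)) = card (walks (parcs G) (square_rel (parcs G)) m)"
proof -
  have sub: "parcs G \<subseteq> pverts G \<times> pverts G" using assms by (auto simp: pair_graph_iff)
  have "bij_betw (\<lambda>p. (\<lambda>i\<in>{..m}. fst (p i), \<lambda>i\<in>{..m}. snd (p i)))
    (walks (parcs G) (square_rel (parcs G)) m) (parcs (walk_graph G m))"
  proof (rule bij_betw_byWitness[where f' = "\<lambda>(w, w'). \<lambda>i\<in>{..m}. (w i, w' i)"])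
    show "(\<lambda>p. (\<lambda>i\<in>{..m}. fst (p i), \<lambda>i\<in>{..m}. snd (p i))) ` walks (parcs G) (square_rel (parcs G)) m
      \<subseteq> parcs (walk_graph G m)"
    proof (rule image_subsetI)
      fix p assume p: "p \<in> walks (parcs G) (square_rel (parcs G)) m"
      then have arc: "(fst (p i), snd (p i)) \<in> parcs G" if "i \<le> m" for i
        using that by (auto simp: walks_def)
      have in_V: "fst (p i) \<in> pverts G" "snd (p i) \<in> pverts G" if "i \<le> m" for i
        using arc[OF that] sub by auto
      have "(p i, p (Suc i)) \<in> square_rel (parcs G)" if "i < m" for i
        using p that by (simp add: walks_def)
      then have step: "(fst (p i), fst (p (Suc i))) \<in> parcs G" "(snd (p i), snd (p (Suc i))) \<in> parcs G"
        if "i < m" for i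
        using that by (fastforce simp: square_rel_def)+
      show "(\<lambda>i\<in>{..m}. fst (p i), \<lambda>i\<in>{..m}. snd (p i)) \<in> parcs (walk_graph G m)"
        using arc step in_V by (auto simp: walk_graph_def walks_def)
    qed
  qed (auto simp: walk_graph_def walks_def square_rel_def PiE_iff extensional_def fun_eq_iff)
  then show ?thesis by (simp add: bij_betw_same_card)
qed

definition hom_rel :: "'a pair_pre_digraph \<Rightarrow> 'b pair_pre_digraph \<Rightarrow> (('a \<Rightarrow> 'b) \<times> ('a \<Rightarrow> 'b)) set" where
  "hom_rel H G = {(h, h'). \<forall>x\<in>pverts H. (h x, h' x) \<in> parcs G}"

lemma sym_hom_rel: "pair_graph G \<Longrightarrow> sym (hom_rel H G)"
  by (auto simp: hom_rel_def sym_def pair_graph_iff)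

lemma finite_Hom: "pair_graph H \<Longrightarrow> pair_graph G \<Longrightarrow> finite (Hom H G)"
  unfolding Hom_def pair_graph_iff
  by (rule finite_subset[of _ "pverts H \<rightarrow>\<^sub>E pverts G"]) (auto intro: finite_PiE)

text \<open>Both sides count arrays of vertices of \<open>G\<close> indexed by a vertex of
  \<open>H\<close> and a time in \<open>{..m}\<close>; the bijection exchanges the two
  indices.\<close>

lemma card_Hom_walk_graph:
  assumes "pair_graph H"
  shows "card (Hom H (walk_graph G m)) = card (walks (Hom H G) (hom_rel H G) m)"
proof -
  have sub: "x \<in> pverts H" "y \<in> pverts H" if "(x, y) \<in> parcs H" for x y
    using assms that by (auto simp: pair_graph_iff)
  have "bij_betw (\<lambda>f. \<lambda>i\<in>{..m}. \<lambda>x\<in>pverts H. f x i) (Hom H (walk_graph G m)) (walks (Hom H G) (hom_rel H G) m)"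
  proof (rule bij_betw_byWitness[where f' = "\<lambda>w. \<lambda>x\<in>pverts H. \<lambda>i\<in>{..m}. w i x"])
    show "\<forall>f\<in>Hom H (walk_graph G m). (\<lambda>x\<in>pverts H. \<lambda>i\<in>{..m}. (\<lambda>i\<in>{..m}. \<lambda>x\<in>pverts H. f x i) i x) = f"
      by (fastforce simp: Hom_def walk_graph_def walks_def PiE_iff extensional_def fun_eq_iff)
    show "\<forall>w\<in>walks (Hom H G) (hom_rel H G) m. (\<lambda>i\<in>{..m}. \<lambda>x\<in>pverts H. (\<lambda>x\<in>pverts H. \<lambda>i\<in>{..m}. w i x) x i) = w"
      by (fastforce simp: Hom_def walks_def PiE_iff extensional_def fun_eq_iff)
    show "(\<lambda>f. \<lambda>i\<in>{..m}. \<lambda>x\<in>pverts H. f x i) ` Hom H (walk_graph G m) \<subseteq> walks (Hom H G) (hom_rel H G) m"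
    proof (rule image_subsetI)
      fix f assume f: "f \<in> Hom H (walk_graph G m)"
      then have V: "f x i \<in> pverts G" if "x \<in> pverts H" "i \<le> m" for x i
        using that by (auto simp: Hom_def walk_graph_def walks_def PiE_iff)
      have step: "(f x i, f x (Suc i)) \<in> parcs G" if "x \<in> pverts H" "i < m" for x i
        using that f by (auto simp: Hom_def walk_graph_def walks_def PiE_iff)
      have rung: "(f x i, f y i) \<in> parcs G" if "(x, y) \<in> parcs H" "i \<le> m" for x y i
        using that f by (auto simp: Hom_def walk_graph_def)
      show "(\<lambda>i\<in>{..m}. \<lambda>x\<in>pverts H. f x i) \<in> walks (Hom H G) (hom_rel H G) m"
        using V step rung sub by (auto simp: walks_def Hom_def hom_rel_def)
    qed
    show "(\<lambda>w. \<lambda>x\<in>pverts H. \<lambda>i\<in>{..m}. w i x) ` walks (Hom H G) (hom_rel H G) m \<subseteq> Hom H (walk_graph G m)"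
    proof (rule image_subsetI)
      fix w assume w: "w \<in> walks (Hom H G) (hom_rel H G) m"
      then have hom: "w i \<in> Hom H G" if "i \<le> m" for i
        using that by (auto simp: walks_def)
      have V: "w i x \<in> pverts G" if "x \<in> pverts H" "i \<le> m" for x i
        using that hom[of i] by (auto simp: Hom_def)
      have step: "(w i x, w (Suc i) x) \<in> parcs G" if "x \<in> pverts H" "i < m" for x i
        using that w by (auto simp: walks_def hom_rel_def)
      have rung: "(w i x, w i y) \<in> parcs G" if "(x, y) \<in> parcs H" "i \<le> m" for x y i
        using that hom[of i] by (auto simp: Hom_def)
      show "(\<lambda>x\<in>pverts H. \<lambda>i\<in>{..m}. w i x) \<in> Hom H (walk_graph G m)"
        using V step rung sub by (auto simp: Hom_def walk_graph_def walks_def)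
    qed
  qed
  then show ?thesis by (rule bij_betw_same_card)
qed

text \<open>The same exchange of indices. A closed walk stores its first entry again at time
  \<open>n\<close>, whereas the cycle has only the layers below \<open>n\<close>; hence the
  reduction modulo \<open>n\<close>.\<close>

lemma card_Hom_box_cycle:
  assumes "pair_graph H" "pair_graph G" "n \<ge> 3"
  shows "card (Hom (H \<box> cycle_graph n) G) = card {w \<in> walks (Hom H G) (hom_rel H G) n. w n = w 0}"
proof -
  have sub: "x \<in> pverts H" "y \<in> pverts H" if "(x, y) \<in> parcs H" for x y
    using assms that by (auto simp: pair_graph_iff)
  have symG: "(a, b) \<in> parcs G \<Longrightarrow> (b, a) \<in> parcs G" for a b
    using assms by (auto simp: pair_graph_iff sym_def)
  have verts: "pverts (H \<box> cycle_graph n) = pverts H \<times> {..<n}"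
    by (simp add: cartesian_product_def cycle_graph_def)
  have "bij_betw (\<lambda>f. \<lambda>i\<in>{..n}. \<lambda>x\<in>pverts H. f (x, i mod n)) (Hom (H \<box> cycle_graph n) G)
    {w \<in> walks (Hom H G) (hom_rel H G) n. w n = w 0}"
  proof (rule bij_betw_byWitness[where f' = "\<lambda>w. \<lambda>p\<in>pverts H \<times> {..<n}. w (snd p) (fst p)"])
    show "\<forall>f\<in>Hom (H \<box> cycle_graph n) G.
      (\<lambda>p\<in>pverts H \<times> {..<n}. (\<lambda>i\<in>{..n}. \<lambda>x\<in>pverts H. f (x, i mod n)) (snd p) (fst p)) = f"
      by (auto simp: Hom_def verts PiE_iff extensional_def fun_eq_iff)
    show "\<forall>w\<in>{w \<in> walks (Hom H G) (hom_rel H G) n. w n = w 0}.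
      (\<lambda>i\<in>{..n}. \<lambda>x\<in>pverts H. (\<lambda>p\<in>pverts H \<times> {..<n}. w (snd p) (fst p)) (x, i mod n)) = w"
    proof
      fix w assume w: "w \<in> {w \<in> walks (Hom H G) (hom_rel H G) n. w n = w 0}"
      have "w (i mod n) = w i" if "i \<le> n" for i
        using w that by (cases "i = n") auto
      moreover have "w i \<in> extensional (pverts H)" if "i \<le> n" for i
        using w that by (auto simp: walks_def Hom_def PiE_iff)
      moreover have "w \<in> extensional {..n}" using w by (auto simp: walks_def PiE_iff)
      ultimately show "(\<lambda>i\<in>{..n}. \<lambda>x\<in>pverts H. (\<lambda>p\<in>pverts H \<times> {..<n}. w (snd p) (fst p)) (x, i mod n)) = w"
        using assms(3) by (auto simp: fun_eq_iff extensional_def)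
    qed
    show "(\<lambda>f. \<lambda>i\<in>{..n}. \<lambda>x\<in>pverts H. f (x, i mod n)) ` Hom (H \<box> cycle_graph n) G
      \<subseteq> {w \<in> walks (Hom H G) (hom_rel H G) n. w n = w 0}"
    proof (rule image_subsetI)
      fix f assume f: "f \<in> Hom (H \<box> cycle_graph n) G"
      have V: "f (x, i) \<in> pverts G" if "x \<in> pverts H" "i < n" for x i
        using that f by (auto simp: Hom_def verts)
      have hom: "(f p, f q) \<in> parcs G" if "(p, q) \<in> parcs (H \<box> cycle_graph n)" for p q
        using that f by (auto simp: Hom_def)
      have step: "(f (x, i mod n), f (x, Suc i mod n)) \<in> parcs G" if "x \<in> pverts H" "i < n" for x i
        using that assms(3) by (intro hom) (auto simp: cartesian_product_def cycle_graph_def)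
      have rung: "(f (x, i), f (y, i)) \<in> parcs G" if "(x, y) \<in> parcs H" "i < n" for x y i
        using that sub by (intro hom) (auto simp: cartesian_product_def cycle_graph_def)
      show "(\<lambda>i\<in>{..n}. \<lambda>x\<in>pverts H. f (x, i mod n)) \<in> {w \<in> walks (Hom H G) (hom_rel H G) n. w n = w 0}"
        using V step rung sub assms(3) by (auto simp: walks_def Hom_def hom_rel_def)
    qed
    show "(\<lambda>w. \<lambda>p\<in>pverts H \<times> {..<n}. w (snd p) (fst p)) ` {w \<in> walks (Hom H G) (hom_rel H G) n. w n = w 0}
      \<subseteq> Hom (H \<box> cycle_graph n) G"
    proof (rule image_subsetI)
      fix w assume w: "w \<in> {w \<in> walks (Hom H G) (hom_rel H G) n. w n = w 0}"
      then have hom: "w i \<in> Hom H G" if "i \<le> n" for i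
        using that by (auto simp: walks_def)
      have V: "w i x \<in> pverts G" if "x \<in> pverts H" "i < n" for x i
        using that hom[of i] by (auto simp: Hom_def)
      have step: "(w i x, w (Suc i mod n) x) \<in> parcs G" if "x \<in> pverts H" "i < n" for x i
      proof -
        have "w (Suc i mod n) = w (Suc i)" using w that by (cases "Suc i = n") auto
        then show ?thesis using that w by (auto simp: walks_def hom_rel_def)
      qed
      have rung: "(w i x, w i y) \<in> parcs G" if "(x, y) \<in> parcs H" "i < n" for x y i
        using that hom[of i] by (auto simp: Hom_def)
      \<comment> \<open>\<open>step\<close> covers the cycle arcs in the forward direction;
        \<open>symG\<close> gives the reversed ones.\<close>
      show "(\<lambda>p\<in>pverts H \<times> {..<n}. w (snd p) (fst p)) \<in> Hom (H \<box> cycle_graph n) G"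
        unfolding Hom_def verts using V step rung symG
        by (auto simp: cartesian_product_def cycle_graph_def)
    qed
  qed
  then show ?thesis by (rule bij_betw_same_card)
qed

section \<open>Comparison of growth rates and conclusion\<close>

text \<open>Constant factors do not affect exponential growth: if \<open>T < P\<close>, then
  \<open>(T / P)^j\<close> falls below \<open>C / D\<close>.\<close>

lemma le_of_power_bounds:
  fixes C D P T :: real
  assumes C: "C > 0" and P: "P > 0" and T: "T \<ge> 0" and bound: "\<And>j. C * P ^ j \<le> D * T ^ j"
  shows "P \<le> T"
proof (rule ccontr)
  assume "\<not> P \<le> T"
  have D: "D > 0" using bound[of 0] C by simp
  have "T / P < 1" using \<open>\<not> P \<le> T\<close> P by simp
  then obtain j where "(T / P) ^ j < C / D"
    using real_arch_pow_inv[of "C / D" "T / P"] C D by auto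
  then have "D * T ^ j < C * P ^ j"
    using P D by (simp add: power_divide field_simps)
  with bound[of j] show False by simp
qed

text \<open>The trace bound at the all-ones vector on \<open>Hom H G\<close>; the trace of the
  \<open>2k\<close>-th power counts the homomorphisms from the product.\<close>

lemma card_walks_Hom_le:
  assumes "pair_graph H" "pair_graph G" "k \<ge> 2"
  shows "real (card (walks (Hom H G) (hom_rel H G) (2 * (k * j)))) \<le>
    real (card (Hom H G)) * real (card (Hom (H \<box> cycle_graph (2 * k)) G)) ^ j"
proof -
  have fin: "finite (Hom H G)" and sy: "sym (hom_rel H G)"
    using assms by (simp_all add: finite_Hom sym_hom_rel)
  interpret X: sym_kernel "Hom H G" "adj_kernel (hom_rel H G)"
    by (rule sym_kernel_adj[OF fin sy])
  have "real (card (Hom (H \<box> cycle_graph (2 * k)) G)) = X.closed_weight (2 * k)"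
    using assms card_closed_walks[OF fin sy] by (simp add: card_Hom_box_cycle)
  moreover have "X.ip (\<lambda>_. 1) (\<lambda>_. 1) = real (card (Hom H G))"
    by (simp add: X.ip_def)
  ultimately show ?thesis
    using X.ip_it_mult_le_closed_weight[of "\<lambda>_. 1" k j]
    by (simp add: card_walks[OF fin sy] X.ip_it_double)
qed

lemma card_Hom_walk_graph_ge:
  assumes H: "pair_graph H" "sidorenko H" and G: "pair_graph G" "parcs G \<noteq> {}" and "even m"
  defines "N \<equiv> real (card (pverts G))" and "d \<equiv> real (card (parcs G)) / real (card (pverts G))"
  shows "(N * d ^ m) ^ card (pverts H) * (d ^ (m + 1) / N ^ (m + 2)) ^ card (uedges H)
    \<le> real (card (Hom H (walk_graph G m)))"
proof -
  interpret adjacency "pverts G" "parcs G"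
    using G(1) by unfold_locales (auto simp: pair_graph_iff)
  have "pverts G \<noteq> {}" using E_subset G(2) by auto
  then have N: "N > 0" using finite_V by (simp add: N_def card_gt_0_iff)
  have d: "d > 0" using N finite_E G(2) by (simp add: d_def N_def card_gt_0_iff)
  define W where "W = real (card (pverts (walk_graph G m)))"
  define Q where "Q = real (card (parcs (walk_graph G m)))"
  have W_eq: "W = A.ip (\<lambda>_. 1) (A.it (\<lambda>_. 1) m)"
    using card_walks[OF finite_V sym_E] by (simp add: W_def walk_graph_def)
  have Q_eq: "Q = Z.ip (\<lambda>_. 1) (Z.it (\<lambda>_. 1) m)"
    using card_walks[OF finite_E sym_square_rel[OF sym_E]] by (simp add: Q_def card_parcs_walk_graph[OF G(1)])
  note bounds = walk_bounds[OF G(2) \<open>even m\<close>, folded N_def d_def W_eq Q_eq]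
  have W: "W > 0" using bounds(1) N d by (meson less_le_trans mult_pos_pos zero_less_power)
  \<comment> \<open>Sidorenko's inequality for the walk graph is a product of powers of
    \<open>W\<close> and of its density \<open>Q / W^2\<close>; each base is bounded below on its
    own.\<close>
  have "d ^ (m + 1) / N ^ (m + 2) \<le> Q / W\<^sup>2"
    using bounds(2) W N by (simp add: field_simps)
  then have "(N * d ^ m) ^ card (pverts H) * (d ^ (m + 1) / N ^ (m + 2)) ^ card (uedges H)
      \<le> W ^ card (pverts H) * (Q / W\<^sup>2) ^ card (uedges H)"
    using bounds(1) N d W by (intro mult_mono power_mono) auto
  also have "\<dots> \<le> real (card (Hom H (walk_graph G m)))"
    using sidorenko_any_type[OF H pair_graph_walk_graph[OF G(1), of m]]
    by (simp add: sidorenko_ineq_def W_def Q_def card_parcs[OF pair_graph_walk_graph[OF G(1)]])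
  finally show ?thesis .
qed

theorem theorem1p4:
  fixes H :: "'a pair_pre_digraph" and k :: nat
  assumes "k \<ge> 2"
    and "pair_graph H"
    and "sidorenko H"
  shows "sidorenko (H \<box> cycle_graph (2 * k))"
  unfolding sidorenko_def
proof (intro allI impI)
  fix G :: "nat pair_pre_digraph"
  assume G: "pair_graph G"
  define v where "v = card (pverts H)"
  define e where "e = card (uedges H)"
  define N where "N = real (card (pverts G))"
  define M where "M = real (card (parcs G))"
  define T where "T = real (card (Hom (H \<box> cycle_graph (2 * k)) G))"
  have C: "pair_graph (cycle_graph (2 * k))" "card (pverts (cycle_graph (2 * k))) = 2 * k"
    "card (uedges (cycle_graph (2 * k))) = 2 * k"
    using \<open>k \<ge> 2\<close> by (simp_all add: pair_graph_cycle_graph card_uedges_cycle_graph) (simp add: cycle_graph_def)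
  have verts: "pverts (H \<box> cycle_graph (2 * k)) = pverts H \<times> pverts (cycle_graph (2 * k))"
    by (simp add: cartesian_product_def)
  have card_verts: "card (pverts (H \<box> cycle_graph (2 * k))) = v * (2 * k)"
    by (simp add: verts card_cartesian_product C v_def)
  have card_edges: "card (uedges (H \<box> cycle_graph (2 * k))) = e * (2 * k) + v * (2 * k)"
    using card_uedges_cartesian_product[OF assms(2) C(1)] by (simp add: C v_def e_def)
  have goal: "sidorenko_ineq (H \<box> cycle_graph (2 * k)) G \<longleftrightarrow>
      N ^ (v * (2 * k)) * (M / N\<^sup>2) ^ (e * (2 * k) + v * (2 * k)) \<le> T"
    by (simp add: sidorenko_ineq_def card_verts card_edges N_def M_def T_def card_parcs[OF G])
  show "sidorenko_ineq (H \<box> cycle_graph (2 * k)) G"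
  proof (cases "pverts H = {} \<or> parcs G = {}")
    case True
    show ?thesis
    proof (cases "pverts H = {}")
      \<comment> \<open>Both exponents are 0, so the bound is 1 even for empty \<open>G\<close>, and
        the empty map attains it.\<close>
      case True
      then have "parcs H = {}" "v = 0" using assms(2) by (auto simp: pair_graph_iff v_def)
      then have "e = 0" by (simp add: e_def uedges_def)
      have "Hom (H \<box> cycle_graph (2 * k)) G = {\<lambda>_. undefined}"
        using True \<open>parcs H = {}\<close> by (auto simp: Hom_def verts) (simp add: cartesian_product_def)
      then show ?thesis unfolding goal by (simp add: T_def \<open>v = 0\<close> \<open>e = 0\<close>)
    next
      case False
      then have "v > 0" using assms(2) by (simp add: v_def pair_graph_iff card_gt_0_iff)
      \<comment> \<open>Without arcs in \<open>G\<close> the density is 0, and its exponent is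
        positive because \<open>v > 0\<close>.\<close>
      have "M = 0" using True False by (simp add: M_def)
      have "(M / N\<^sup>2) ^ (e * (2 * k) + v * (2 * k)) = 0"
        unfolding \<open>M = 0\<close> div_0 using \<open>v > 0\<close> \<open>k \<ge> 2\<close> by (intro zero_power) simp
      then show ?thesis unfolding goal T_def by (simp only: mult_zero_right of_nat_0_le_iff)
    qed
  next
    case False
    have "finite (parcs G)" using G by (auto simp: pair_graph_iff intro: finite_subset)
    then have M: "M > 0" using False by (simp add: M_def card_gt_0_iff)
    have N: "N > 0" using G False by (auto simp: N_def pair_graph_iff card_gt_0_iff)
    define d where "d = M / N"
    have d: "d > 0" using M N by (simp add: d_def)
    \<comment> \<open>\<open>P\<close> is the growth rate in \<open>j\<close> of the lower bound for
      walks of length \<open>2kj\<close>, and \<open>c\<close> collects the factors independent of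
      \<open>j\<close>.\<close>
    define P where "P = (d ^ (2 * k)) ^ v * ((d / N) ^ (2 * k)) ^ e"
    define c where "c = N ^ v * (d / N\<^sup>2) ^ e"
    have regroup: "a ^ v * b ^ e * (x ^ v * y ^ e) ^ j = (a * x ^ j) ^ v * (b * y ^ j) ^ e"
      for a b x y :: real and j
      by (simp add: power_mult_distrib mult_ac flip: power_mult)
    have "c * P ^ j \<le> real (card (Hom H G)) * T ^ j" for j
    proof -
      let ?m = "2 * (k * j)"
      have "d ^ (?m + 1) / N ^ (?m + 2) = d / N\<^sup>2 * ((d / N) ^ (2 * k)) ^ j"
        using N by (simp add: power_divide power2_eq_square mult.assoc flip: power_mult)
      moreover have "N * d ^ ?m = N * (d ^ (2 * k)) ^ j"
        by (simp add: mult.assoc flip: power_mult)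
      ultimately have "c * P ^ j = (N * d ^ ?m) ^ v * (d ^ (?m + 1) / N ^ (?m + 2)) ^ e"
        unfolding c_def P_def by (metis regroup)
      also have "\<dots> \<le> real (card (Hom H (walk_graph G ?m)))"
        unfolding d_def N_def M_def v_def e_def using assms G False
        by (intro card_Hom_walk_graph_ge) auto
      also have "\<dots> \<le> real (card (Hom H G)) * T ^ j"
        unfolding card_Hom_walk_graph[OF assms(2)] T_def by (rule card_walks_Hom_le[OF assms(2) G assms(1)])
      finally show ?thesis .
    qed
    moreover have "c > 0" "P > 0" "T \<ge> 0"
      using N d by (simp_all add: c_def P_def T_def)
    ultimately have "P \<le> T" by (metis le_of_power_bounds)
    \<comment> \<open>As \<open>d\<close> is \<open>N\<close> times the edge density
      \<open>d / N\<close>, the growth rate is exactly the Sidorenko bound for the product.\<close>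
    moreover have "P = N ^ (v * (2 * k)) * (M / N\<^sup>2) ^ (e * (2 * k) + v * (2 * k))"
    proof -
      have "M / N\<^sup>2 = d / N" by (simp add: d_def power2_eq_square)
      moreover have "d ^ (v * (2 * k)) = N ^ (v * (2 * k)) * (d / N) ^ (v * (2 * k))"
        using N by (simp flip: power_mult_distrib)
      ultimately show ?thesis by (simp add: P_def power_add mult_ac flip: power_mult)
    qed
    ultimately show ?thesis unfolding goal by simp
  qed
qed

end
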